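(* Let $\mathfrak p_1,\mathfrak p_2\in D_n^A$ have height sequences $(h^{(1)}_1,\dots,h^{(1)}_n)$ and $(h^{(2)}_1,\dots,h^{(2)}_n)$. Then the relative pseudocomplement $\mathfrak p_1\to\mathfrak p_2$ in $\mathcal{D}_n^A$ is the Dyck path $\mathfrak p\in D_n^A$ with height sequence $(h_1,\dots,h_n)$ defined (recursively from the right) by $$h_i=\begin{cases} h_{i+1},& i<n \text{ and } h^{(1)}_i\le h^{(2)}_i,\\ h^{(2)}_i,& i=n, \text{ or } i<n\text{ and } h^{(1)}_i>h^{(2)}_i.\end{cases}$$
   Context: $D_n^A$ is the set of Dyck paths of type $A$ of semilength $n$: words of length $2n$ over $\{u,r\}$ with exactly $n$ $u$'s and $n$ $r$'s such that every prefix has at least as many $u$'s as $r$'s. The height sequence of such a word is $(h_1,\dots,h_n)$, $h_i$ the number of $u$'s preceding the $i$-th $r$; these are exactly the integer sequences with $h_1\le\dots\le h_n$ and $i\le h_i\le n$ for all $i$. $\mathcal{D}_n^A$ is $D_n^A$ ordered componentwise by height sequences (dominance order); it is a distributive lattice with meet/join the componentwise min/max. The relative pseudocomplement $x\to y$ is the greatest $z$ with $x\wedge z\le y$. *)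

theory Defs
  imports "HOL-Algebra.Lattice"
begin

datatype step = U | R

definition dyck_paths :: "nat \<Rightarrow> step list set" where
  "dyck_paths n = {w. length w = 2 * n \<and> count_list w U = n \<and> count_list w R = n \<and>
     (\<forall>k\<le>length w. count_list (take k w) R \<le> count_list (take k w) U)}"

definition height_seq :: "step list \<Rightarrow> nat list" where
  "height_seq w = map (\<lambda>p. count_list (take p w) U) (filter (\<lambda>p. w ! p = R) [0..<length w])"

(* 1-based: meaningful only for i between 1 and the number of R's in w. *)
definition height :: "step list \<Rightarrow> nat \<Rightarrow> nat" where
  "height w i = height_seq w ! (i - 1)"

definition dyck_lattice :: "nat \<Rightarrow> step list gorder" where
  "dyck_lattice n = \<lparr>carrier = dyck_paths n, eq = (=),
     le = (\<lambda>v w. list_all2 (\<le>) (height_seq v) (height_seq w))\<rparr>"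

definition is_rel_pseudocomplement ::
    "('a, 'b) gorder_scheme \<Rightarrow> 'a \<Rightarrow> 'a \<Rightarrow> 'a \<Rightarrow> bool" where
  "is_rel_pseudocomplement L x y p \<longleftrightarrow>
     greatest L p {z \<in> carrier L. x \<sqinter>\<^bsub>L\<^esub> z \<sqsubseteq>\<^bsub>L\<^esub> y}"

function rpc_height :: "nat \<Rightarrow> (nat \<Rightarrow> nat) \<Rightarrow> (nat \<Rightarrow> nat) \<Rightarrow> nat \<Rightarrow> nat" where
  "rpc_height n h1 h2 i =
     (if i < n \<and> h1 i \<le> h2 i then rpc_height n h1 h2 (i + 1) else h2 i)"
  by auto
termination by (relation "measure (\<lambda>(n, _, _, i). n - i)") auto

(* As a rewrite rule the defining equation may unfold forever. *)
declare rpc_height.simps [simp del]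

end

theory Submission
  imports Defs
begin

text \<open>A word is determined by its height sequence and its number of \<^const>\<open>U\<close>'s, and
  \<^const>\<open>height_seq\<close> maps the Dyck paths bijectively onto the sorted sequences
  \<open>i \<le> h\<^sub>i \<le> n\<close>. Meets are therefore componentwise minima, so \<open>x \<sqinter> z \<sqsubseteq> y\<close> says precisely that
  \<open>z\<^sub>i \<le> y\<^sub>i\<close> at every index with \<open>x\<^sub>i > y\<^sub>i\<close>. The greatest monotone \<open>z\<close> obeying these constraints
  takes at \<open>i\<close> the value \<open>y\<^sub>j\<close> for the first constrained \<open>j \<ge> i\<close>, or \<open>n = y\<^sub>n\<close> if there is none;
  that is the recursion from the right.\<close>

section \<open>Height sequences\<close>

lemma height_seq_Nil [simp]: "height_seq [] = []"
  by (simp add: height_seq_def)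

text \<open>Prepending a letter shifts every position by one. This turns the positional definition
  of \<open>height_seq\<close> into the recursion that the inductions on words use.\<close>

lemma filter_nth_Cons_upt:
  "filter (\<lambda>p. P ((x # xs) ! p)) [0..<Suc k] =
     (if P x then [0] else []) @ map Suc (filter (\<lambda>p. P (xs ! p)) [0..<k])"
proof -
  have "[0..<Suc k] = 0 # map Suc [0..<k]"
    by (simp add: upt_conv_Cons map_Suc_upt del: upt_Suc)
  then show ?thesis
    by (simp add: filter_map o_def del: upt_Suc)
qed

lemma height_seq_U [simp]: "height_seq (U # w) = map Suc (height_seq w)"
  using filter_nth_Cons_upt[of "\<lambda>s. s = R" U w "length w"]
  by (simp add: height_seq_def o_def del: upt_Suc)

lemma height_seq_R [simp]: "height_seq (R # w) = 0 # height_seq w"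
  using filter_nth_Cons_upt[of "\<lambda>s. s = R" R w "length w"]
  by (simp add: height_seq_def o_def del: upt_Suc)

lemma height_seq_replicate_U [simp]:
  "height_seq (replicate k U @ w) = map ((+) k) (height_seq w)"
  by (induction k) (auto simp: o_def)

lemma length_height_seq [simp]: "length (height_seq w) = count_list w R"
proof (induction w)
  case (Cons s w)
  then show ?case by (cases s) auto
qed simp

lemma count_list_U_add_R: "count_list w U + count_list w R = length w"
proof (induction w)
  case (Cons s w)
  then show ?case by (cases s) auto
qed simp

lemma sorted_height_seq: "sorted (height_seq w)"
proof (induction w)
  case (Cons s w)
  then show ?case by (cases s) (auto simp: sorted_map)
qed simp

lemma height_seq_le: "x \<in> set (height_seq w) \<Longrightarrow> x \<le> count_list w U"
proof (induction w arbitrary: x)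
  case (Cons s w)
  then show ?case by (cases s) auto
qed simp

text \<open>The first letter can be read off: it is \<open>R\<close> exactly when the sequence
  starts with 0. The \<open>U\<close>-count is needed because \<open>U\<close>'s after the last
  \<open>R\<close> leave no trace in the sequence.\<close>

lemma height_seq_inject:
  "height_seq v = height_seq w \<Longrightarrow> count_list v U = count_list w U \<Longrightarrow> v = w"
proof (induction v arbitrary: w)
  case Nil
  then have "length w = 0"
    using count_list_U_add_R[of w] length_height_seq[of w] by simp
  then show ?case by simp
next
  case (Cons s v)
  have "w \<noteq> []"
    using Cons.prems by (cases s) auto
  then obtain t w' where w: "w = t # w'"
    by (cases w) auto
  show ?case
    using Cons unfolding w
    by (cases s; cases t) (auto simp: inj_map_eq_map Cons_eq_map_conv map_eq_Cons_conv)
qed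

text \<open>Here \<open>k\<close> counts the \<open>U\<close>'s already written. Each entry
  \<open>a\<close> asks for \<open>a - k\<close> further \<open>U\<close>'s and one
  \<open>R\<close>; the word ends with the \<open>U\<close>'s still missing from
  \<open>m\<close>.\<close>

lemma height_seq_surject:
  assumes "sorted h" and "\<And>x. x \<in> set h \<Longrightarrow> k \<le> x \<and> x \<le> m" and "k \<le> m"
  shows "\<exists>w. count_list w U = m - k \<and> map ((+) k) (height_seq w) = h"
  using assms
proof (induction h arbitrary: k)
  case Nil
  have "count_list (replicate j U) U = j" for j by (induction j) auto
  then show ?case
    using height_seq_replicate_U[of "m - k" "[]"] by (intro exI[of _ "replicate (m - k) U"]) simp
next
  case (Cons a h)
  have a: "k \<le> a" "a \<le> m" using Cons.prems by auto
  have "\<exists>w. count_list w U = m - a \<and> map ((+) a) (height_seq w) = h"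
    using Cons.prems by (intro Cons.IH) auto
  then obtain w where w: "count_list w U = m - a" "map ((+) a) (height_seq w) = h"
    by blast
  have "count_list (replicate j U @ R # w) U = j + count_list w U" for j
    by (induction j) auto
  then show ?case
    using w a by (intro exI[of _ "replicate (a - k) U @ R # w"]) (auto simp: o_def)
qed

text \<open>The offset \<open>c\<close> is the excess of \<^const>\<open>U\<close>'s in the part of the path preceding \<open>w\<close>.\<close>

lemma ballot_iff_height_seq:
  "(\<forall>k\<le>length w. count_list (take k w) R \<le> c + count_list (take k w) U) \<longleftrightarrow>
   (\<forall>i<count_list w R. i < c + height_seq w ! i)"
proof (induction w arbitrary: c)
  case (Cons s w)
  have all_le_Suc: "(\<forall>k\<le>Suc m. P k) \<longleftrightarrow> P 0 \<and> (\<forall>k\<le>m. P (Suc k))" for P m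
    by (metis Suc_le_mono le0 not0_implies_Suc)
  show ?case
  proof (cases s)
    case U
    then show ?thesis
      using Cons[of "Suc c"] by (simp add: all_le_Suc)
  next
    case R
    \<comment> \<open>A leading \<open>R\<close> uses up one unit of the excess \<open>c\<close>. If
      \<open>c = 0\<close>, both sides fail at once: the left at the prefix of length 1, the right
      at index 0.\<close>
    show ?thesis
    proof (cases c)
      case 0
      then show ?thesis using R by (auto simp: all_le_Suc)
    next
      case (Suc d)
      then show ?thesis
        using R Cons[of d] by (simp add: all_le_Suc All_less_Suc2)
    qed
  qed
qed simp

text \<open>List positions start at 0, so the bound \<open>i \<le> h\<^sub>i\<close> of the 1-based
  description becomes the strict \<open>i < h ! i\<close>.\<close>

definition dyck_heights :: "nat \<Rightarrow> nat list set" where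
  "dyck_heights n = {h. length h = n \<and> sorted h \<and> (\<forall>i<n. i < h ! i \<and> h ! i \<le> n)}"

lemma bij_betw_height_seq: "bij_betw height_seq (dyck_paths n) (dyck_heights n)"
proof (intro bij_betw_imageI inj_onI)
  fix v w assume "v \<in> dyck_paths n" "w \<in> dyck_paths n" "height_seq v = height_seq w"
  then show "v = w" by (simp add: height_seq_inject dyck_paths_def)
next
  show "height_seq ` dyck_paths n = dyck_heights n"
  proof (intro equalityI subsetI)
    fix h assume "h \<in> height_seq ` dyck_paths n"
    then obtain w where w: "w \<in> dyck_paths n" "h = height_seq w" by blast
    have "\<forall>i<n. i < h ! i"
      using w ballot_iff_height_seq[of w 0] by (simp add: dyck_paths_def)
    moreover have "\<forall>i<n. h ! i \<le> n"
      using w height_seq_le[of _ w] by (auto simp: dyck_paths_def)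
    ultimately show "h \<in> dyck_heights n"
      using w by (auto simp: dyck_heights_def sorted_height_seq dyck_paths_def)
  next
    fix h assume h: "h \<in> dyck_heights n"
    have "\<exists>w. count_list w U = n - 0 \<and> map ((+) 0) (height_seq w) = h"
      using h by (intro height_seq_surject) (auto simp: dyck_heights_def in_set_conv_nth)
    then obtain w where w: "count_list w U = n" "height_seq w = h"
      by (auto simp: map_idI)
    have "count_list w R = n"
      using w h length_height_seq[of w] by (simp add: dyck_heights_def)
    then have "w \<in> dyck_paths n"
      using w h count_list_U_add_R[of w] ballot_iff_height_seq[of w 0]
      by (simp add: dyck_paths_def dyck_heights_def)
    then show "h \<in> height_seq ` dyck_paths n" using w by blast
  qed
qed

lemma height_seq_in_dyck_heights: "w \<in> dyck_paths n \<Longrightarrow> height_seq w \<in> dyck_heights n"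
  using bij_betw_height_seq by (rule bij_betwE[THEN bspec])

section \<open>The dominance order\<close>

lemma carrier_dyck_lattice [simp]: "carrier (dyck_lattice n) = dyck_paths n"
  by (simp add: dyck_lattice_def)

lemma le_dyck_lattice_iff:
  assumes "v \<in> dyck_paths n" and "w \<in> dyck_paths n"
  shows "v \<sqsubseteq>\<^bsub>dyck_lattice n\<^esub> w \<longleftrightarrow> (\<forall>i<n. height_seq v ! i \<le> height_seq w ! i)"
  using assms by (simp add: dyck_lattice_def list_all2_conv_all_nth dyck_paths_def)

lemma map2_min_in_dyck_heights:
  assumes "g \<in> dyck_heights n" and "h \<in> dyck_heights n"
  shows "map2 min g h \<in> dyck_heights n"
  using assms by (auto simp: dyck_heights_def sorted_iff_nth_mono min_le_iff_disj)

lemma meet_dyck_lattice: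
  assumes v: "v \<in> dyck_paths n" and w: "w \<in> dyck_paths n"
  shows "v \<sqinter>\<^bsub>dyck_lattice n\<^esub> w \<in> dyck_paths n"
    and "i < n \<Longrightarrow> height_seq (v \<sqinter>\<^bsub>dyck_lattice n\<^esub> w) ! i = min (height_seq v ! i) (height_seq w ! i)"
proof -
  let ?L = "dyck_lattice n"
  let ?m = "v \<sqinter>\<^bsub>?L\<^esub> w"
  have len: "length (height_seq v) = n" "length (height_seq w) = n"
    using v w by (auto simp: dyck_paths_def)
  have "map2 min (height_seq v) (height_seq w) \<in> height_seq ` dyck_paths n"
    using v w bij_betw_height_seq[of n]
    by (simp add: bij_betw_def map2_min_in_dyck_heights height_seq_in_dyck_heights)
  then obtain g where g: "g \<in> dyck_paths n"
      and hg: "height_seq g = map2 min (height_seq v) (height_seq w)"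
    by (metis imageE)
  have g_nth: "height_seq g ! i = min (height_seq v ! i) (height_seq w ! i)" if "i < n" for i
    using that len by (simp add: hg)
  have Lower: "x \<in> Lower ?L {v, w} \<longleftrightarrow> x \<in> dyck_paths n \<and>
      (\<forall>i<n. height_seq x ! i \<le> height_seq v ! i) \<and> (\<forall>i<n. height_seq x ! i \<le> height_seq w ! i)" for x
    using v w by (auto simp: Lower_def le_dyck_lattice_iff)
  have "greatest ?L g (Lower ?L {v, w})"
    using g by (auto simp: greatest_def Lower g_nth le_dyck_lattice_iff)
  \<comment> \<open>The meet is a Hilbert choice, so its property rests on the witness
    \<open>g\<close>. Comparing the two greatest lower bounds in both directions then gives their
    heights as equal.\<close>
  then have m: "greatest ?L ?m (Lower ?L {v, w})"
    unfolding meet_def inf_def by (rule someI)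
  then show mem: "?m \<in> dyck_paths n"
    by (auto simp: greatest_def Lower)
  have "g \<sqsubseteq>\<^bsub>?L\<^esub> ?m"
    using m g by (simp add: greatest_def Lower g_nth)
  then show "i < n \<Longrightarrow> height_seq ?m ! i = min (height_seq v ! i) (height_seq w ! i)"
    using m g mem by (fastforce simp: greatest_def Lower le_dyck_lattice_iff g_nth intro!: antisym)
qed

section \<open>The recursion from the right\<close>

lemma rpc_height_eq_right: "i < n \<Longrightarrow> f i \<le> g i \<Longrightarrow> rpc_height n f g i = rpc_height n f g (Suc i)"
  by (subst rpc_height.simps) simp

lemma rpc_height_eq_self: "\<not> (i < n \<and> f i \<le> g i) \<Longrightarrow> rpc_height n f g i = g i"
  by (subst rpc_height.simps) auto

text \<open>Unfolding from \<open>i\<close> stops at some \<open>j\<close> with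
  \<open>i \<le> j \<le> n\<close> and returns \<open>g j\<close>. Positions start at
  \<open>k\<close> because 1-based heights are inserted later, with \<open>k = 1\<close>.\<close>

lemma rpc_height_ge:
  assumes "\<And>i. k \<le> i \<Longrightarrow> i < n \<Longrightarrow> g i \<le> g (Suc i)" and "k \<le> i" and "i \<le> n"
  shows "g i \<le> rpc_height n f g i"
  using assms(3,2)
proof (induction rule: inc_induct)
  case (step i)
  then show ?case
    using assms(1)[of i] by (cases "f i \<le> g i") (auto simp: rpc_height_eq_right rpc_height_eq_self)
qed (simp add: rpc_height_eq_self)

lemma rpc_height_Suc:
  assumes "\<And>i. k \<le> i \<Longrightarrow> i < n \<Longrightarrow> g i \<le> g (Suc i)" and "k \<le> i" and "i < n"
  shows "rpc_height n f g i \<le> rpc_height n f g (Suc i)"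
proof (cases "f i \<le> g i")
  case False
  then show ?thesis
    using rpc_height_ge[of k n g "Suc i" f] assms order_trans by (fastforce simp: rpc_height_eq_self)
qed (use assms in \<open>simp add: rpc_height_eq_right\<close>)

lemma rpc_height_le:
  assumes "\<And>i. k \<le> i \<Longrightarrow> i \<le> n \<Longrightarrow> g i \<le> b" and "k \<le> i" and "i \<le> n"
  shows "rpc_height n f g i \<le> b"
  using assms(3,2)
proof (induction rule: inc_induct)
  case (step i)
  then show ?case
    using assms(1)[of i] by (cases "f i \<le> g i") (auto simp: rpc_height_eq_right rpc_height_eq_self)
qed (use assms in \<open>simp add: rpc_height_eq_self\<close>)

text \<open>Downward induction from \<open>n\<close>. Where \<open>f i \<le> g i\<close>,
  monotonicity of \<open>z\<close> passes the bound on from \<open>Suc i\<close>; where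
  \<open>f i > g i\<close>, the bound on the minimum forces \<open>z i \<le> g i\<close>.\<close>

lemma rpc_height_greatest:
  assumes mono: "\<And>i. k \<le> i \<Longrightarrow> i < n \<Longrightarrow> z i \<le> z (Suc i)"
    and le: "\<And>i. k \<le> i \<Longrightarrow> i < n \<Longrightarrow> min (f i) (z i) \<le> g i"
    and "z n \<le> g n" and "k \<le> i" and "i \<le> n"
  shows "z i \<le> rpc_height n f g i"
  using assms(5,4)
proof (induction rule: inc_induct)
  case (step i)
  then show ?case
    using mono[of i] le[of i]
    by (cases "f i \<le> g i") (auto simp: rpc_height_eq_right rpc_height_eq_self min_le_iff_disj)
qed (use assms in \<open>simp add: rpc_height_eq_self\<close>)

section \<open>One-based heights of Dyck paths and the pseudocomplement\<close>

lemma height_Suc [simp]: "height w (Suc i) = height_seq w ! i"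
  by (simp add: height_def)

lemma dyck_height:
  assumes "w \<in> dyck_paths n"
  shows "1 \<le> i \<Longrightarrow> i < n \<Longrightarrow> height w i \<le> height w (Suc i)"
    and "1 \<le> i \<Longrightarrow> i \<le> n \<Longrightarrow> i \<le> height w i"
    and "1 \<le> i \<Longrightarrow> i \<le> n \<Longrightarrow> height w i \<le> n"
proof -
  have h: "height_seq w \<in> dyck_heights n"
    using assms by (rule height_seq_in_dyck_heights)
  show "1 \<le> i \<Longrightarrow> i < n \<Longrightarrow> height w i \<le> height w (Suc i)"
    using h by (cases i) (auto simp: dyck_heights_def sorted_iff_nth_mono)
  show "1 \<le> i \<Longrightarrow> i \<le> n \<Longrightarrow> i \<le> height w i"
    using h by (cases i) (auto simp: dyck_heights_def Suc_le_eq)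
  show "1 \<le> i \<Longrightarrow> i \<le> n \<Longrightarrow> height w i \<le> n"
    using h by (cases i) (auto simp: dyck_heights_def)
qed

lemma nth_map_upt_1: "i < n \<Longrightarrow> map f [1..<n + 1] ! i = f (Suc i)"
  by (simp del: upt_Suc)

text \<open>The value at \<open>i\<close> is a height of \<open>w\<close> at \<open>i\<close> or
  further right, so the bounds by \<open>i\<close> and \<open>n\<close> carry over from
  \<open>w\<close>.\<close>

lemma rpc_heights_in_dyck_heights:
  assumes "w \<in> dyck_paths n"
  shows "map (rpc_height n f (height w)) [1..<n + 1] \<in> dyck_heights n" (is "?h \<in> _")
proof -
  note mono = dyck_height(1)[OF assms]
  have "sorted ?h"
    unfolding sorted_iff_nth_Suc
    using rpc_height_Suc[of 1 n "height w" _ f, OF mono] by (auto simp: nth_map_upt_1 simp del: upt_Suc)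
  moreover have "i < ?h ! i \<and> ?h ! i \<le> n" if "i < n" for i
    using that dyck_height(2)[OF assms, of "Suc i"]
      rpc_height_ge[of 1 n "height w" "Suc i" f, OF mono]
      rpc_height_le[of 1 n "height w" n "Suc i" f, OF dyck_height(3)[OF assms]]
    by (simp add: nth_map_upt_1 del: upt_Suc)
  ultimately show ?thesis
    by (simp add: dyck_heights_def del: upt_Suc)
qed

lemma is_rel_pseudocomplement_rpc:
  assumes p1: "p1 \<in> dyck_paths n" and p2: "p2 \<in> dyck_paths n" and p: "p \<in> dyck_paths n"
    and hp: "height_seq p = map (rpc_height n (height p1) (height p2)) [1..<n + 1]"
  shows "is_rel_pseudocomplement (dyck_lattice n) p1 p2 p"
proof -
  let ?L = "dyck_lattice n"
  have p_nth: "height_seq p ! i = rpc_height n (height p1) (height p2) (Suc i)" if "i < n" for i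
    using that by (simp add: hp nth_map_upt_1 del: upt_Suc)
  have meet_le: "p1 \<sqinter>\<^bsub>?L\<^esub> z \<sqsubseteq>\<^bsub>?L\<^esub> p2 \<longleftrightarrow>
      (\<forall>i<n. min (height_seq p1 ! i) (height_seq z ! i) \<le> height_seq p2 ! i)"
    if "z \<in> dyck_paths n" for z
    using that p1 p2 by (simp add: le_dyck_lattice_iff meet_dyck_lattice)
  \<comment> \<open>Where \<open>p1\<close> exceeds \<open>p2\<close> the recursion stops, so
    \<open>p\<close> and \<open>p2\<close> agree there; elsewhere \<open>p1\<close> alone keeps the
    minimum small.\<close>
  have "min (height_seq p1 ! i) (height_seq p ! i) \<le> height_seq p2 ! i" if "i < n" for i
    using that
    by (cases "height_seq p1 ! i \<le> height_seq p2 ! i") (auto simp: p_nth rpc_height_eq_self)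
  then have "p1 \<sqinter>\<^bsub>?L\<^esub> p \<sqsubseteq>\<^bsub>?L\<^esub> p2"
    using p by (simp add: meet_le)
  moreover have "z \<sqsubseteq>\<^bsub>?L\<^esub> p" if z: "z \<in> dyck_paths n" and le: "p1 \<sqinter>\<^bsub>?L\<^esub> z \<sqsubseteq>\<^bsub>?L\<^esub> p2" for z
  proof -
    have "height z (Suc i) \<le> rpc_height n (height p1) (height p2) (Suc i)" if "i < n" for i
    proof (rule rpc_height_greatest[of 1])
      show "height z j \<le> height z (Suc j)" if "1 \<le> j" "j < n" for j
        using that dyck_height(1)[OF z] by simp
      show "min (height p1 j) (height z j) \<le> height p2 j" if "1 \<le> j" "j < n" for j
        using that le z by (cases j) (simp_all add: meet_le)
      \<comment> \<open>The last height of a Dyck path is \<open>n\<close>: \<open>z\<close> has at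
        most this value and \<open>p2\<close> at least. The assumption \<open>i < n\<close> makes
        position \<open>n\<close> a valid 1-based index.\<close>
      show "height z n \<le> height p2 n"
        using \<open>i < n\<close> dyck_height(3)[OF z, of n] dyck_height(2)[OF p2, of n] by simp
    qed (use that in auto)
    then show ?thesis
      using z p by (simp add: le_dyck_lattice_iff p_nth)
  qed
  ultimately show ?thesis
    using p by (simp add: is_rel_pseudocomplement_def greatest_def)
qed

theorem theorem3p5:
  fixes n :: nat and p1 p2 :: "step list"
  assumes "p1 \<in> dyck_paths n" and "p2 \<in> dyck_paths n"
  shows "(\<exists>!p. p \<in> dyck_paths n \<and>
            height_seq p = map (rpc_height n (height p1) (height p2)) [1..<n + 1]) \<and>
         (\<forall>p \<in> dyck_paths n.
            height_seq p = map (rpc_height n (height p1) (height p2)) [1..<n + 1] \<longrightarrow>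
            is_rel_pseudocomplement (dyck_lattice n) p1 p2 p)"
proof (intro conjI ballI impI)
  show "\<exists>!p. p \<in> dyck_paths n \<and>
            height_seq p = map (rpc_height n (height p1) (height p2)) [1..<n + 1]"
    \<comment> \<open>Existence is surjectivity of \<open>height_seq\<close> onto
      \<open>dyck_heights n\<close>, uniqueness its injectivity on Dyck paths.\<close>
    using rpc_heights_in_dyck_heights[OF assms(2)] bij_betw_height_seq[of n]
    unfolding bij_betw_def inj_on_def by (smt (verit) imageE)
qed (rule is_rel_pseudocomplement_rpc[OF assms])

end
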